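(* Let $(r_n)$ be a positive deterministic sequence with $r_n\downarrow0$. (i) If $\Delta_n=O_{\mathbb P^{*}}(r_n)$, then $\hat\psi_n-\psi^{*}=O_{\mathbb P^{*}}(r_n)$. Moreover, for every nonnegative deterministic sequence $\delta_n=O(r_n)$ and every sequence of maps $\hat x_n:\Omega\to X$ satisfying the empirical minimizer membership assumption with respect to $(\delta_n)$, $f(\hat x_n)-\psi^{*}=O_{\mathbb P^{*}}(r_n)$. If, in addition, $f$ satisfies sharp growth of order $\kappa$, then $\operatorname{dist}(\hat x_n,S^{0})=O_{\mathbb P^{*}}(r_n^{1/\kappa})$. (ii) If $\Delta_n=O_{\mathrm{as}^{*}}(r_n)$, then $\lvert\hat\psi_n-\psi^{*}\rvert=O_{\mathrm{as}^{*}}(r_n)$. For every nonnegative deterministic sequence $\delta_n=O(r_n)$ and every sequence of maps $\hat x_n:\Omega\to X$ satisfying the empirical minimizer membership assumption with respect to $(\delta_n)$, $f(\hat x_n)-\psi^{*}=O_{\mathrm{as}^{*}}(r_n)$ and, under sharp growth of order $\kappa$, $\operatorname{dist}(\hat x_n,S^{0})=O_{\mathrm{as}^{*}}(r_n^{1/\kappa})$. (iii) If $\mathbb E^{*}\Delta_n=O(r_n)$, then $\mathbb E^{*}\lvert\hat\psi_n-\psi^{*}\rvert=O(r_n)$. If, in addition, $\delta_n=O(r_n)$ for a nonnegative deterministic sequence $(\delta_n)$ and $\hat x_n:\Omega\to X$ satisfy the empirical minimizer membership assumption with respect to $(\delta_n)$ with events $A_{\min,N}$ that can be chosen so that $\mathbb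 P(A_{\min,n}^{c})=O(r_n)$, then $\mathbb E^{*}[f(\hat x_n)-\psi^{*}]=O(r_n)$ and, under sharp growth of order $\kappa$, $\mathbb E^{*}\operatorname{dist}(\hat x_n,S^{0})^{\kappa}=O(r_n)$.
   Context: Setting. $(\Omega,\mathcal F,\mathbb P)$ is a probability space, $(\Xi,\mathcal G)$ a measurable space, $\xi,\xi_1,\xi_2,\dots$ are i.i.d. $\Xi$-valued random elements on $\Omega$ with law $P$, $X$ is a nonempty set, and $h:X\times\Xi\to\mathbb R$ is such that each section $h_x=h(x,\cdot)$ is measurable and $P$-integrable. Put $f(x)=\mathbb E[h(x,\xi)]$, $\hat f_n(x)=\frac1n\sum_{i=1}^n h(x,\xi_i)$, $\psi^{*}=\inf_{X}f$, $\hat\psi_n=\inf_{X}\hat f_n$, $S^{\varepsilon}=\{x\in X: f(x)\le\psi^{*}+\varepsilon\}$, $\hat S_n^{\delta}=\{x\in X:\hat f_n(x)\le\hat\psi_n+\delta\}$ ($\varepsilon,\delta\ge0$; $\hat S_n^\delta=\hat S_n^\delta(\omega)$ is random), and $\Delta_n=\sup_{x\in X}|\hat f_n(x)-f(x)|$. Standing assumption (bounded-objective regime): $f$ is bounded on $X$, and, for all sufficiently large $n$, $\hat f_n-f$ is bounded on $X$ almost surely. Empirical minimizer membership assumption (for maps $\hat x_n:\Omega\to X$ and nonnegative deterministic $(\delta_n)$): there are events $A_{\min,N}\in\mathcal F$, $N\in\mathbb N$, with $A_{\min,N}\subseteq A_{\min,N+1}$ and $\mathbb P(\bigcup_N A_{\min,N})=1$,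 such that $\hat x_n(\omega)\in\hat S_n^{\delta_n}(\omega)$ for every $N$, every $\omega\in A_{\min,N}$ and every $n\ge N$. Sharp growth of order $\kappa\ge1$: $X\subseteq\mathbb R^d$, $S^{0}\ne\varnothing$, and there is $\alpha>0$ with $f(x)-\psi^{*}\ge\alpha\operatorname{dist}(x,S^{0})^{\kappa}$ for all $x\in X$ (Euclidean distance). Outer notions. For a possibly nonmeasurable $U:\Omega\to[-\infty,\infty]$, $\mathbb E^{*}U=\inf\{\mathbb E[V]: V\ge U,\ V\text{ measurable},\ \mathbb E[V]\text{ exists}\}$, $\mathbb P^{*}(A)=\mathbb E^{*}\mathbf 1_A$. $U_n=O_{\mathbb P^{*}}(r_n)$: for every $\varepsilon>0$ there is $M<\infty$ with $\limsup_n\mathbb P^{*}(|U_n|>Mr_n)\le\varepsilon$. $U^{*}$ denotes a version of the minimal measurable majorant of $U$ (a measurable $U^*\ge U$ with $U^*\le V$ a.s. for every measurable $V\ge U$ a.s.). $U_n=O_{\mathrm{as}^{*}}(r_n)$: for some versions of the minimal measurable majorants, $\limsup_n|U_n|^{*}/r_n<\infty$ almost surely. *)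

theory Defs
  imports "HOL-Probability.Probability" "HOL-Library.Landau_Symbols"
begin

text \<open>
  Suprema, infima and all functionals that may be infinite are taken in \<^typ>\<open>ereal\<close>, since for
  exceptional outcomes or small sample sizes the empirical objective need not be bounded.
\<close>

subsection \<open>Outer expectation, outer probability and stochastic orders\<close>

text \<open>
  The expectation of an extended-real random variable exists when the positive and the
  negative part do not both have infinite integral. Note that \<^const>\<open>e2ennreal\<close> maps negative
  values to 0, so it yields the positive part.
\<close>

definition ext_expectation_exists :: "'a measure \<Rightarrow> ('a \<Rightarrow> ereal) \<Rightarrow> bool" where
  "ext_expectation_exists M V \<longleftrightarrow>
     (\<integral>\<^sup>+\<omega>. e2ennreal (V \<omega>) \<partial>M) < \<infinity> \<or> (\<integral>\<^sup>+\<omega>. e2ennreal (- V \<omega>) \<partial>M) < \<infinity>"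

definition ext_expectation :: "'a measure \<Rightarrow> ('a \<Rightarrow> ereal) \<Rightarrow> ereal" where
  "ext_expectation M V =
     enn2ereal (\<integral>\<^sup>+\<omega>. e2ennreal (V \<omega>) \<partial>M) - enn2ereal (\<integral>\<^sup>+\<omega>. e2ennreal (- V \<omega>) \<partial>M)"

definition outer_expectation :: "'a measure \<Rightarrow> ('a \<Rightarrow> ereal) \<Rightarrow> ereal" where
  "outer_expectation M U =
     Inf {ext_expectation M V | V. V \<in> borel_measurable M \<and> (\<forall>\<omega>\<in>space M. U \<omega> \<le> V \<omega>)
                                   \<and> ext_expectation_exists M V}"

definition outer_prob :: "'a measure \<Rightarrow> 'a set \<Rightarrow> ereal" where
  "outer_prob M A = outer_expectation M (indicator A)"

definition bigo_outer_prob :: "'a measure \<Rightarrow> (nat \<Rightarrow> 'a \<Rightarrow> ereal) \<Rightarrow> (nat \<Rightarrow> real) \<Rightarrow> bool" where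
  "bigo_outer_prob M U r \<longleftrightarrow>
     (\<forall>\<epsilon>::real. \<epsilon> > 0 \<longrightarrow> (\<exists>K::real.
        limsup (\<lambda>n. outer_prob M {\<omega>\<in>space M. \<bar>U n \<omega>\<bar> > ereal (K * r n)}) \<le> ereal \<epsilon>))"

definition minimal_measurable_majorant :: "'a measure \<Rightarrow> ('a \<Rightarrow> ereal) \<Rightarrow> ('a \<Rightarrow> ereal) \<Rightarrow> bool" where
  "minimal_measurable_majorant M U U' \<longleftrightarrow>
     U' \<in> borel_measurable M \<and> (\<forall>\<omega>\<in>space M. U \<omega> \<le> U' \<omega>) \<and>
     (\<forall>V\<in>borel_measurable M. (AE \<omega> in M. U \<omega> \<le> V \<omega>) \<longrightarrow> (AE \<omega> in M. U' \<omega> \<le> V \<omega>))"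

definition bigo_outer_as :: "'a measure \<Rightarrow> (nat \<Rightarrow> 'a \<Rightarrow> ereal) \<Rightarrow> (nat \<Rightarrow> real) \<Rightarrow> bool" where
  "bigo_outer_as M U r \<longleftrightarrow>
     (\<exists>V. (\<forall>n. minimal_measurable_majorant M (\<lambda>\<omega>. \<bar>U n \<omega>\<bar>) (V n)) \<and>
          (AE \<omega> in M. limsup (\<lambda>n. V n \<omega> / ereal (r n)) < \<infinity>))"

text \<open>Landau's O for deterministic extended-real sequences, finitely many terms of which may be
  infinite.\<close>

definition bigo_ereal :: "(nat \<Rightarrow> ereal) \<Rightarrow> (nat \<Rightarrow> real) \<Rightarrow> bool" where
  "bigo_ereal a r \<longleftrightarrow> (\<exists>C::real. \<forall>\<^sub>F n in sequentially. \<bar>a n\<bar> \<le> ereal (C * r n))"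

subsection \<open>Sample average approximation\<close>

text \<open>
  The random elements are indexed by all naturals: \<open>\<xi> 0\<close> is the generic copy used in the true
  objective, and \<open>\<xi> 1, \<xi> 2, \<dots>\<close> is the sample. Sequences in the sample size are indexed by all
  naturals too; the index 0 carries no information, as the empirical objective is then
  constantly 0 and all asserted rates are asymptotic.
\<close>

definition true_obj :: "'a measure \<Rightarrow> ('x \<Rightarrow> 'b \<Rightarrow> real) \<Rightarrow> (nat \<Rightarrow> 'a \<Rightarrow> 'b) \<Rightarrow> 'x \<Rightarrow> real" where
  "true_obj M h \<xi> x = (\<integral>\<omega>. h x (\<xi> 0 \<omega>) \<partial>M)"

definition emp_obj :: "('x \<Rightarrow> 'b \<Rightarrow> real) \<Rightarrow> (nat \<Rightarrow> 'a \<Rightarrow> 'b) \<Rightarrow> nat \<Rightarrow> 'x \<Rightarrow> 'a \<Rightarrow> real" where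
  "emp_obj h \<xi> n x \<omega> = 1 / real n * (\<Sum>i=1..n. h x (\<xi> i \<omega>))"

definition true_val :: "'a measure \<Rightarrow> 'x set \<Rightarrow> ('x \<Rightarrow> 'b \<Rightarrow> real) \<Rightarrow> (nat \<Rightarrow> 'a \<Rightarrow> 'b) \<Rightarrow> ereal" where
  "true_val M X h \<xi> = (INF x\<in>X. ereal (true_obj M h \<xi> x))"

definition emp_val :: "'x set \<Rightarrow> ('x \<Rightarrow> 'b \<Rightarrow> real) \<Rightarrow> (nat \<Rightarrow> 'a \<Rightarrow> 'b) \<Rightarrow> nat \<Rightarrow> 'a \<Rightarrow> ereal" where
  "emp_val X h \<xi> n \<omega> = (INF x\<in>X. ereal (emp_obj h \<xi> n x \<omega>))"

definition true_sol ::
  "'a measure \<Rightarrow> 'x set \<Rightarrow> ('x \<Rightarrow> 'b \<Rightarrow> real) \<Rightarrow> (nat \<Rightarrow> 'a \<Rightarrow> 'b) \<Rightarrow> real \<Rightarrow> 'x set" where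
  "true_sol M X h \<xi> \<epsilon> = {x\<in>X. ereal (true_obj M h \<xi> x) \<le> true_val M X h \<xi> + ereal \<epsilon>}"

definition emp_sol ::
  "'x set \<Rightarrow> ('x \<Rightarrow> 'b \<Rightarrow> real) \<Rightarrow> (nat \<Rightarrow> 'a \<Rightarrow> 'b) \<Rightarrow> nat \<Rightarrow> real \<Rightarrow> 'a \<Rightarrow> 'x set" where
  "emp_sol X h \<xi> n \<delta> \<omega> = {x\<in>X. ereal (emp_obj h \<xi> n x \<omega>) \<le> emp_val X h \<xi> n \<omega> + ereal \<delta>}"

definition sup_dev ::
  "'a measure \<Rightarrow> 'x set \<Rightarrow> ('x \<Rightarrow> 'b \<Rightarrow> real) \<Rightarrow> (nat \<Rightarrow> 'a \<Rightarrow> 'b) \<Rightarrow> nat \<Rightarrow> 'a \<Rightarrow> ereal" where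
  "sup_dev M X h \<xi> n \<omega> = (SUP x\<in>X. ereal \<bar>emp_obj h \<xi> n x \<omega> - true_obj M h \<xi> x\<bar>)"

definition bounded_regime ::
  "'a measure \<Rightarrow> 'x set \<Rightarrow> ('x \<Rightarrow> 'b \<Rightarrow> real) \<Rightarrow> (nat \<Rightarrow> 'a \<Rightarrow> 'b) \<Rightarrow> bool" where
  "bounded_regime M X h \<xi> \<longleftrightarrow>
     bounded (true_obj M h \<xi> ` X) \<and>
     (\<forall>\<^sub>F n in sequentially. AE \<omega> in M.
        bounded ((\<lambda>x. emp_obj h \<xi> n x \<omega> - true_obj M h \<xi> x) ` X))"

definition min_membership_events ::
  "'a measure \<Rightarrow> 'x set \<Rightarrow> ('x \<Rightarrow> 'b \<Rightarrow> real) \<Rightarrow> (nat \<Rightarrow> 'a \<Rightarrow> 'b) \<Rightarrow> (nat \<Rightarrow> real) \<Rightarrow>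
   (nat \<Rightarrow> 'a \<Rightarrow> 'x) \<Rightarrow> (nat \<Rightarrow> 'a set) \<Rightarrow> bool" where
  "min_membership_events M X h \<xi> \<delta> xh A \<longleftrightarrow>
     (\<forall>N. A N \<in> sets M) \<and> (\<forall>N. A N \<subseteq> A (Suc N)) \<and> measure M (\<Union>N. A N) = 1 \<and>
     (\<forall>N. \<forall>\<omega>\<in>A N. \<forall>n\<ge>N. xh n \<omega> \<in> emp_sol X h \<xi> n (\<delta> n) \<omega>)"

definition min_membership ::
  "'a measure \<Rightarrow> 'x set \<Rightarrow> ('x \<Rightarrow> 'b \<Rightarrow> real) \<Rightarrow> (nat \<Rightarrow> 'a \<Rightarrow> 'b) \<Rightarrow> (nat \<Rightarrow> real) \<Rightarrow>
   (nat \<Rightarrow> 'a \<Rightarrow> 'x) \<Rightarrow> bool" where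
  "min_membership M X h \<xi> \<delta> xh \<longleftrightarrow> (\<exists>A. min_membership_events M X h \<xi> \<delta> xh A)"

text \<open>
  The feasible set lives in an arbitrary type; only sharp growth needs it to be a subset of
  Euclidean space. This is expressed by an injection \<open>\<iota>\<close> that identifies \<open>X\<close> with a
  subset of \<open>\<real>\<^sup>d\<close>; for \<open>X\<close> given as a subset of \<open>\<real>\<^sup>d\<close> it is the identity.
\<close>

definition dist_sol ::
  "'a measure \<Rightarrow> 'x set \<Rightarrow> ('x \<Rightarrow> 'b \<Rightarrow> real) \<Rightarrow> (nat \<Rightarrow> 'a \<Rightarrow> 'b) \<Rightarrow> ('x \<Rightarrow> real ^ 'd) \<Rightarrow> 'x \<Rightarrow> real" where
  "dist_sol M X h \<xi> \<iota> x = infdist (\<iota> x) (\<iota> ` true_sol M X h \<xi> 0)"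

definition sharp_growth ::
  "'a measure \<Rightarrow> 'x set \<Rightarrow> ('x \<Rightarrow> 'b \<Rightarrow> real) \<Rightarrow> (nat \<Rightarrow> 'a \<Rightarrow> 'b) \<Rightarrow> ('x \<Rightarrow> real ^ 'd) \<Rightarrow> real \<Rightarrow> bool" where
  "sharp_growth M X h \<xi> \<iota> \<kappa> \<longleftrightarrow>
     \<kappa> \<ge> 1 \<and> inj_on \<iota> X \<and> true_sol M X h \<xi> 0 \<noteq> {} \<and>
     (\<exists>\<alpha>::real. \<alpha> > 0 \<and> (\<forall>x\<in>X.
        ereal (true_obj M h \<xi> x) - true_val M X h \<xi> \<ge> ereal (\<alpha> * dist_sol M X h \<xi> \<iota> x powr \<kappa>)))"

end

theory Submission
  imports Defs
begin

text \<open>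
  Everything reduces to three inequalities that hold for every outcome \<open>\<omega>\<close>:
  \<open>\<bar>emp_val - true_val\<bar> \<le> \<Delta>\<close>, \<open>f x - true_val \<le> 2 \<Delta> + \<delta>\<close> for every empirical
  \<open>\<delta>\<close>-minimizer \<open>x\<close>, and \<open>\<alpha> dist(x, S\<^sup>0)\<^sup>\<kappa> \<le> f x - true_val\<close>.
  Each says that a bound \<open>\<bar>U n\<bar> \<le> K r n\<close> implies \<open>\<bar>V n\<bar> \<le> K' s n\<close> on events of
  probability tending to 1, and implications of this kind transport outer stochastic orders.
  For the outer means, the exceptional event is paid for by the boundedness of \<open>f\<close>.
\<close>

section \<open>Outer expectations of nonnegative functions\<close>

text \<open>An \<open>ennreal\<close>-valued majorant has vanishing negative part, so its extended
  expectation exists and it competes in the infimum. With \<open>outer_expectation_lessD\<close> as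
  converse, outer expectations of nonnegative functions reduce to nonnegative integrals.\<close>

lemma outer_expectation_le_nn_integral:
  assumes "V \<in> borel_measurable M" "\<And>\<omega>. \<omega> \<in> space M \<Longrightarrow> U \<omega> \<le> enn2ereal (V \<omega>)"
  shows "outer_expectation M U \<le> enn2ereal (\<integral>\<^sup>+\<omega>. V \<omega> \<partial>M)"
proof -
  have neg: "(\<integral>\<^sup>+\<omega>. e2ennreal (- enn2ereal (V \<omega>)) \<partial>M) = 0"
    by (simp add: e2ennreal_neg)
  then have "ext_expectation M (\<lambda>\<omega>. enn2ereal (V \<omega>)) = enn2ereal (\<integral>\<^sup>+\<omega>. V \<omega> \<partial>M)"
    "ext_expectation_exists M (\<lambda>\<omega>. enn2ereal (V \<omega>))"
    by (simp_all add: ext_expectation_def ext_expectation_exists_def zero_ennreal.rep_eq)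
  moreover have "(\<lambda>\<omega>. enn2ereal (V \<omega>)) \<in> borel_measurable M"
    using assms(1) by measurable
  ultimately show ?thesis
    unfolding outer_expectation_def using assms(2) by (intro Inf_lower) force
qed

lemma ext_expectation_nonneg_eq:
  assumes "\<And>\<omega>. \<omega> \<in> space M \<Longrightarrow> 0 \<le> V \<omega>"
  shows "ext_expectation M V = enn2ereal (\<integral>\<^sup>+\<omega>. e2ennreal (V \<omega>) \<partial>M)"
proof -
  have "(\<integral>\<^sup>+\<omega>. e2ennreal (- V \<omega>) \<partial>M) = (\<integral>\<^sup>+\<omega>. 0 \<partial>M)"
    by (intro nn_integral_cong e2ennreal_neg) (simp add: assms)
  then show ?thesis
    by (simp add: ext_expectation_def zero_ennreal.rep_eq)
qed

lemma outer_expectation_nonneg: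
  assumes "\<And>\<omega>. \<omega> \<in> space M \<Longrightarrow> 0 \<le> U \<omega>"
  shows "0 \<le> outer_expectation M U"
  unfolding outer_expectation_def
proof (rule Inf_greatest, clarify)
  fix V assume "\<forall>\<omega>\<in>space M. U \<omega> \<le> V \<omega>"
  then have "\<And>\<omega>. \<omega> \<in> space M \<Longrightarrow> 0 \<le> V \<omega>"
    using assms order_trans by blast
  then show "0 \<le> ext_expectation M V"
    by (simp add: ext_expectation_nonneg_eq)
qed

text \<open>Whatever dominates a nonnegative \<open>U\<close> is itself nonnegative on
  \<open>space M\<close>, so passing to \<open>e2ennreal\<close> loses nothing. The strict bound
  yields a competitor without the infimum having to be attained.\<close>

lemma outer_expectation_lessD:
  assumes "\<And>\<omega>. \<omega> \<in> space M \<Longrightarrow> 0 \<le> U \<omega>" and "outer_expectation M U < c"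
  obtains V where "V \<in> borel_measurable M"
    "\<And>\<omega>. \<omega> \<in> space M \<Longrightarrow> U \<omega> \<le> enn2ereal (V \<omega>)" "enn2ereal (\<integral>\<^sup>+\<omega>. V \<omega> \<partial>M) < c"
proof -
  from assms(2) obtain V where V: "V \<in> borel_measurable M" "\<forall>\<omega>\<in>space M. U \<omega> \<le> V \<omega>"
    "ext_expectation M V < c"
    unfolding outer_expectation_def Inf_less_iff by blast
  have nonneg: "\<And>\<omega>. \<omega> \<in> space M \<Longrightarrow> 0 \<le> V \<omega>"
    using V(2) assms(1) order_trans by blast
  show thesis
  proof
    show "(\<lambda>\<omega>. e2ennreal (V \<omega>)) \<in> borel_measurable M"
      using V(1) by measurable
    show "U \<omega> \<le> enn2ereal (e2ennreal (V \<omega>))" if "\<omega> \<in> space M" for \<omega>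
      using V(2) nonneg that by (simp add: enn2ereal_e2ennreal)
    show "enn2ereal (\<integral>\<^sup>+\<omega>. e2ennreal (V \<omega>) \<partial>M) < c"
      using V(3) nonneg by (simp add: ext_expectation_nonneg_eq)
  qed
qed

lemma outer_expectation_mono:
  assumes "\<And>\<omega>. \<omega> \<in> space M \<Longrightarrow> U \<omega> \<le> V \<omega>"
  shows "outer_expectation M U \<le> outer_expectation M V"
  unfolding outer_expectation_def by (rule Inf_superset_mono) (use assms order_trans in blast)

context prob_space
begin

text \<open>If \<open>V\<close> majorizes \<open>U\<close> with integral below \<open>c\<close>,
  then \<open>a V + b\<close> plus \<open>B\<close> times the indicator of the complement of
  \<open>A\<close> majorizes \<open>W\<close>. This one estimate serves the comparison of outer
  probabilities as well as the outer means of the excess and of the distance.\<close>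

lemma outer_expectation_affine_less:
  fixes a b B c :: real
  assumes U: "\<And>\<omega>. \<omega> \<in> space M \<Longrightarrow> 0 \<le> U \<omega>" and c: "outer_expectation M U < ereal c"
    and "0 \<le> a" "0 \<le> b" "0 \<le> B" and A: "A \<in> sets M"
    and le: "\<And>\<omega>. \<omega> \<in> A \<Longrightarrow> W \<omega> \<le> ereal a * U \<omega> + ereal b"
      "\<And>\<omega>. \<omega> \<in> space M - A \<Longrightarrow> W \<omega> \<le> ereal B"
  shows "outer_expectation M W \<le> ereal (a * c + b + B * prob (space M - A))"
proof -
  obtain V where V[measurable]: "V \<in> borel_measurable M"
    and UV: "\<And>\<omega>. \<omega> \<in> space M \<Longrightarrow> U \<omega> \<le> enn2ereal (V \<omega>)"
    and Vc: "enn2ereal (\<integral>\<^sup>+\<omega>. V \<omega> \<partial>M) < ereal c"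
    using outer_expectation_lessD[OF U c] by blast
  \<comment> \<open>The conversions between \<open>ereal\<close> and \<open>ennreal\<close> below
    are faithful only for nonnegative reals.\<close>
  have "0 \<le> c"
    using Vc enn2ereal_nonneg[of "\<integral>\<^sup>+\<omega>. V \<omega> \<partial>M"] by (metis ereal_less_eq(5) le_less_trans less_imp_le)
  have Vc': "(\<integral>\<^sup>+\<omega>. V \<omega> \<partial>M) \<le> ennreal c"
    using Vc \<open>0 \<le> c\<close> by (simp add: less_eq_ennreal.rep_eq enn2ereal_ennreal)
  let ?V = "\<lambda>\<omega>. ennreal a * V \<omega> + ennreal b + ennreal B * indicator (space M - A) \<omega>"
  have "W \<omega> \<le> enn2ereal (?V \<omega>)" if "\<omega> \<in> space M" for \<omega>
  proof (cases "\<omega> \<in> A")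
    case True
    have "W \<omega> \<le> ereal a * U \<omega> + ereal b" by (rule le) fact
    also have "\<dots> \<le> ereal a * enn2ereal (V \<omega>) + ereal b"
      using UV[OF that] \<open>0 \<le> a\<close> by (intro add_right_mono ereal_mult_left_mono) auto
    finally show ?thesis
      using True \<open>0 \<le> a\<close> \<open>0 \<le> b\<close>
      by (simp add: plus_ennreal.rep_eq times_ennreal.rep_eq enn2ereal_ennreal)
  next
    case False
    then have "W \<omega> \<le> ereal B" using that by (intro le) auto
    also have "\<dots> = enn2ereal (ennreal B)" using \<open>0 \<le> B\<close> by (simp add: enn2ereal_ennreal)
    also have "\<dots> \<le> enn2ereal (?V \<omega>)"
      using False that by (simp flip: less_eq_ennreal.rep_eq)
    finally show ?thesis .
  qed
  then have "outer_expectation M W \<le> enn2ereal (\<integral>\<^sup>+\<omega>. ?V \<omega> \<partial>M)"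
    using A by (intro outer_expectation_le_nn_integral) auto
  also have "(\<integral>\<^sup>+\<omega>. ?V \<omega> \<partial>M) =
      ennreal a * (\<integral>\<^sup>+\<omega>. V \<omega> \<partial>M) + ennreal b + ennreal B * emeasure M (space M - A)"
    using A by (simp add: nn_integral_add nn_integral_cmult nn_integral_cmult_indicator emeasure_space_1)
  also have "\<dots> \<le> ennreal a * ennreal c + ennreal b + ennreal B * emeasure M (space M - A)"
    by (intro add_right_mono mult_left_mono Vc') auto
  also have "\<dots> = ennreal (a * c + b + B * prob (space M - A))"
    using \<open>0 \<le> a\<close> \<open>0 \<le> b\<close> \<open>0 \<le> B\<close> \<open>0 \<le> c\<close>
    by (simp add: emeasure_eq_measure ennreal_mult ennreal_plus)
  also have "enn2ereal \<dots> = ereal (a * c + b + B * prob (space M - A))"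
    using \<open>0 \<le> a\<close> \<open>0 \<le> b\<close> \<open>0 \<le> B\<close> \<open>0 \<le> c\<close> by (intro enn2ereal_ennreal) simp
  finally show ?thesis
    by (simp add: less_eq_ennreal.rep_eq)
qed

text \<open>This is the affine estimate for indicators, with \<open>a = 1\<close> and
  \<open>b = 0\<close> on \<open>A\<close> and the trivial bound \<open>B = 1\<close> off
  \<open>A\<close>.\<close>

lemma outer_prob_le_add_prob:
  assumes A: "A \<in> sets M" and "S' \<inter> A \<subseteq> S"
  shows "outer_prob M S' \<le> outer_prob M S + ereal (prob (space M - A))"
proof -
  have S: "\<And>\<omega>. 0 \<le> (indicator S \<omega> :: ereal)" by (simp add: indicator_def)
  \<comment> \<open>Testing against real upper bounds \<open>c\<close> avoids a case distinction on
    infinite values. The slack \<open>e\<close> supplies the strict inequality that the affine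
    estimate demands and is removed at the end.\<close>
  have "outer_prob M S' - ereal (prob (space M - A)) \<le> outer_prob M S"
  proof (rule ereal_le_real)
    fix c assume "outer_prob M S \<le> ereal c"
    have le_e: "outer_prob M S' \<le> ereal (1 * (c + e) + 0 + 1 * prob (space M - A))" if "0 < e" for e
      unfolding outer_prob_def
    proof (rule outer_expectation_affine_less[OF S _ _ _ _ A])
      show "outer_expectation M (indicator S) < ereal (c + e)"
        using le_less_trans[OF \<open>outer_prob M S \<le> ereal c\<close>, of "ereal (c + e)"] that
        by (simp add: outer_prob_def)
    qed (use assms(2) in \<open>auto simp: indicator_def\<close>)
    have "outer_prob M S' \<le> ereal (c + prob (space M - A)) + ereal e" if "0 < e" for e
      using le_e[OF that] by (simp add: add_ac)
    then have "outer_prob M S' \<le> ereal (c + prob (space M - A))"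
      by (rule ereal_le_epsilon2)
    then show "outer_prob M S' - ereal (prob (space M - A)) \<le> ereal c"
      by (simp add: ereal_minus_le)
  qed
  then show ?thesis
    by (simp add: ereal_minus_le)
qed

section \<open>Transport of outer stochastic orders\<close>

text \<open>The majorant takes at \<open>\<omega>\<close> the supremum of the rationals \<open>q\<close> for which \<open>\<omega>\<close> lies in a
  measurable hull of \<open>{U > q}\<close>.\<close>

lemma minimal_measurable_majorant_exists: "\<exists>U'. minimal_measurable_majorant M U U'"
proof -
  let ?S = "\<lambda>q::rat. {\<omega>\<in>space M. ereal (of_rat q) < U \<omega>}"
  have "\<exists>E\<in>sets M. ?S q \<subseteq> E \<and> outer_measure_of M (?S q) = emeasure M E" for q
    by (rule outer_measure_of_attain) auto
  then obtain E where E[measurable]: "\<And>q. E q \<in> sets M" and SE: "\<And>q. ?S q \<subseteq> E q"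
    and outer_eq: "\<And>q. outer_measure_of M (?S q) = emeasure M (E q)"
    by metis
  \<comment> \<open>The hull \<open>E q\<close> is minimal up to null sets: intersecting it with
    another measurable superset of \<open>?S q\<close> cannot lower its measure, and since the
    measure is finite, the difference is null.\<close>
  have E_minus: "emeasure M (E q - C) = 0" if C[measurable]: "C \<in> sets M" and "?S q \<subseteq> C" for C q
  proof -
    have "outer_measure_of M (?S q) \<le> outer_measure_of M (E q \<inter> C)"
      using SE that by (intro outer_measure_of_mono) auto
    then have "emeasure M (E q) \<le> emeasure M (E q \<inter> C)"
      by (simp add: outer_eq)
    then have "prob (E q) \<le> prob (E q \<inter> C)"
      by (simp add: emeasure_eq_measure)
    moreover have "prob (E q - C) = prob (E q) - prob (E q \<inter> C)"
      by (rule finite_measure_Diff') auto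
    ultimately have "prob (E q - C) \<le> 0"
      by simp
    then show ?thesis
      by (simp add: emeasure_eq_measure measure_le_0_iff)
  qed
  \<comment> \<open>The default \<open>- \<infinity>\<close> is neutral for the supremum and covers
    outcomes that lie in no hull.\<close>
  define U' where "U' \<omega> = (SUP q. if \<omega> \<in> E q then ereal (of_rat q) else - \<infinity>)" for \<omega>
  have "minimal_measurable_majorant M U U'"
    unfolding minimal_measurable_majorant_def
  proof (intro conjI ballI impI)
    show "U' \<in> borel_measurable M"
      unfolding U'_def by measurable
  next
    fix \<omega> assume \<omega>: "\<omega> \<in> space M"
    show "U \<omega> \<le> U' \<omega>"
    proof (rule ccontr)
      assume "\<not> U \<omega> \<le> U' \<omega>"
      \<comment> \<open>Density in \<open>ereal\<close> provides real intermediate points. Two of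
        them are taken so that a rational fits between them.\<close>
      then obtain x where x: "U' \<omega> < ereal x" "ereal x < U \<omega>"
        using ereal_dense2[of "U' \<omega>" "U \<omega>"] by (auto simp: not_le)
      then obtain y where y: "ereal x < ereal y" "ereal y < U \<omega>"
        using ereal_dense2[of "ereal x" "U \<omega>"] by auto
      then obtain q where q: "x < of_rat q" "of_rat q < y"
        using y(1) of_rat_dense[of x y] by auto
      have "\<omega> \<in> ?S q"
        using \<omega> q y by (auto intro: less_trans[of _ "ereal y"])
      then have "\<omega> \<in> E q" using SE by blast
      then have "ereal (of_rat q) \<le> U' \<omega>"
        unfolding U'_def by (intro SUP_upper2[of q]) auto
      then have "ereal (of_rat q) < ereal x" using x(1) by (rule le_less_trans)
      with q show False by simp
    qed
  next
    fix V assume V[measurable]: "V \<in> borel_measurable M" and "AE \<omega> in M. U \<omega> \<le> V \<omega>"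
    then obtain N where N[measurable]: "N \<in> sets M" and N0: "emeasure M N = 0"
      and UV: "{\<omega>\<in>space M. \<not> U \<omega> \<le> V \<omega>} \<subseteq> N"
      by (auto elim: AE_E)
    have "AE \<omega> in M. \<omega> \<in> E q \<longrightarrow> ereal (of_rat q) \<le> V \<omega>" for q
    proof -
      \<comment> \<open>Adding the null set \<open>N\<close> makes the inclusion of
        \<open>?S q\<close> hold everywhere, as \<open>E_minus\<close> requires; only null sets are
        lost by it.\<close>
      let ?C = "{\<omega>\<in>space M. ereal (of_rat q) < V \<omega>} \<union> N"
      have "?S q \<subseteq> ?C"
        using UV by (auto intro: less_le_trans)
      then have "E q - ?C \<in> null_sets M"
        by (intro null_setsI E_minus) auto
      moreover have "N \<in> null_sets M"
        using N0 by auto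
      ultimately show ?thesis
        by (intro AE_I'[of "(E q - ?C) \<union> N"]) auto
    qed
    then have "AE \<omega> in M. \<forall>q. \<omega> \<in> E q \<longrightarrow> ereal (of_rat q) \<le> V \<omega>"
      by (simp add: AE_all_countable)
    then show "AE \<omega> in M. U' \<omega> \<le> V \<omega>"
      by eventually_elim (unfold U'_def, rule SUP_least, auto)
  qed
  then show ?thesis by blast
qed

text \<open>On \<open>A n\<close>, eventually, the event that \<open>\<bar>V n\<bar>\<close> exceeds
  \<open>K' * s n\<close> lies in the event that \<open>\<bar>U n\<bar>\<close> exceeds
  \<open>K * r n\<close>. The rest costs at most the probability of the complement, which vanishes
  in the limsup, so the same \<epsilon> serves.\<close>

lemma bigo_outer_prob_transfer:
  assumes U: "bigo_outer_prob M U r"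
    and A: "\<And>n. A n \<in> sets M" and lim: "(\<lambda>n. prob (space M - A n)) \<longlonglongrightarrow> 0"
    and imp: "\<And>K. \<exists>K'. \<forall>\<^sub>F n in sequentially. \<forall>\<omega>\<in>A n.
        \<bar>U n \<omega>\<bar> \<le> ereal (K * r n) \<longrightarrow> \<bar>V n \<omega>\<bar> \<le> ereal (K' * s n)"
  shows "bigo_outer_prob M V s"
  unfolding bigo_outer_prob_def
proof (intro allI impI)
  fix \<epsilon> :: real assume "0 < \<epsilon>"
  then obtain K where K: "limsup (\<lambda>n. outer_prob M {\<omega>\<in>space M. ereal (K * r n) < \<bar>U n \<omega>\<bar>}) \<le> ereal \<epsilon>"
    using U unfolding bigo_outer_prob_def by blast
  obtain K' where K': "\<forall>\<^sub>F n in sequentially. \<forall>\<omega>\<in>A n.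
        \<bar>U n \<omega>\<bar> \<le> ereal (K * r n) \<longrightarrow> \<bar>V n \<omega>\<bar> \<le> ereal (K' * s n)"
    using imp by blast
  let ?p = "\<lambda>n. ereal (prob (space M - A n))"
  have "\<forall>\<^sub>F n in sequentially. outer_prob M {\<omega>\<in>space M. ereal (K' * s n) < \<bar>V n \<omega>\<bar>}
      \<le> outer_prob M {\<omega>\<in>space M. ereal (K * r n) < \<bar>U n \<omega>\<bar>} + ?p n"
    using K'
  proof eventually_elim
    case (elim n)
    then show ?case
      by (intro outer_prob_le_add_prob A) (force simp flip: not_le)
  qed
  then have "limsup (\<lambda>n. outer_prob M {\<omega>\<in>space M. ereal (K' * s n) < \<bar>V n \<omega>\<bar>})
      \<le> limsup (\<lambda>n. outer_prob M {\<omega>\<in>space M. ereal (K * r n) < \<bar>U n \<omega>\<bar>} + ?p n)"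
    by (rule Limsup_mono)
  also have "\<dots> \<le> limsup (\<lambda>n. outer_prob M {\<omega>\<in>space M. ereal (K * r n) < \<bar>U n \<omega>\<bar>}) + limsup ?p"
    by (rule ereal_limsup_add_mono)
  also have "limsup ?p = 0"
    using lim by (intro lim_imp_Limsup) (auto simp: zero_ereal_def)
  finally show "\<exists>K. limsup (\<lambda>n. outer_prob M {\<omega>\<in>space M. ereal (K * s n) < \<bar>V n \<omega>\<bar>}) \<le> ereal \<epsilon>"
    using K by (auto intro: order_trans)
qed

text \<open>The implication speaks of \<open>U\<close> and \<open>V\<close>, whereas the order
  speaks of their majorants. The bound reaches the majorant of \<open>\<bar>V n\<bar>\<close> by
  minimality, once it is written as a measurable function that dominates
  \<open>\<bar>V n\<bar>\<close>.\<close>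

lemma bigo_outer_as_transfer:
  assumes U: "bigo_outer_as M U r" and pos: "\<And>n. 0 < r n" "\<And>n. 0 < s n"
    and A[measurable]: "\<And>n. A n \<in> sets M"
    and ev: "AE \<omega> in M. \<forall>\<^sub>F n in sequentially. \<omega> \<in> A n"
    and imp: "\<And>K. \<exists>K'. \<forall>\<^sub>F n in sequentially. \<forall>\<omega>\<in>A n.
        \<bar>U n \<omega>\<bar> \<le> ereal (K * r n) \<longrightarrow> \<bar>V n \<omega>\<bar> \<le> ereal (K' * s n)"
  shows "bigo_outer_as M V s"
proof -
  obtain U' where U': "\<And>n. minimal_measurable_majorant M (\<lambda>\<omega>. \<bar>U n \<omega>\<bar>) (U' n)"
    and U'_lim: "AE \<omega> in M. limsup (\<lambda>n. U' n \<omega> / ereal (r n)) < \<infinity>"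
    using U unfolding bigo_outer_as_def by blast
  have U'_meas[measurable]: "\<And>n. U' n \<in> borel_measurable M"
    and U'_ge: "\<And>n \<omega>. \<omega> \<in> space M \<Longrightarrow> \<bar>U n \<omega>\<bar> \<le> U' n \<omega>"
    using U' unfolding minimal_measurable_majorant_def by auto
  define V' where "V' n = (SOME W. minimal_measurable_majorant M (\<lambda>\<omega>. \<bar>V n \<omega>\<bar>) W)" for n
  have V': "minimal_measurable_majorant M (\<lambda>\<omega>. \<bar>V n \<omega>\<bar>) (V' n)" for n
    unfolding V'_def by (rule someI_ex[OF minimal_measurable_majorant_exists])
  have V'_min: "AE \<omega> in M. V' n \<omega> \<le> W \<omega>"
    if "W \<in> borel_measurable M" "AE \<omega> in M. \<bar>V n \<omega>\<bar> \<le> W \<omega>" for n W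
    using V'[of n] that unfolding minimal_measurable_majorant_def by blast
  \<comment> \<open>The constant \<open>K'\<close> and the threshold \<open>n0\<close> are chosen as
    functions of \<open>K\<close> before an outcome is fixed; they will depend on the outcome only
    through \<open>K\<close>.\<close>
  from imp have "\<forall>K. \<exists>K'. \<forall>\<^sub>F n in sequentially. \<forall>\<omega>\<in>A n.
        \<bar>U n \<omega>\<bar> \<le> ereal (K * r n) \<longrightarrow> \<bar>V n \<omega>\<bar> \<le> ereal (K' * s n)"
    by blast
  from choice[OF this] obtain K' where "\<forall>K. \<forall>\<^sub>F n in sequentially. \<forall>\<omega>\<in>A n.
        \<bar>U n \<omega>\<bar> \<le> ereal (K * r n) \<longrightarrow> \<bar>V n \<omega>\<bar> \<le> ereal (K' K * s n)"
    by blast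
  then have "\<forall>K. \<exists>n0. \<forall>n\<ge>n0. \<forall>\<omega>\<in>A n.
        \<bar>U n \<omega>\<bar> \<le> ereal (K * r n) \<longrightarrow> \<bar>V n \<omega>\<bar> \<le> ereal (K' K * s n)"
    unfolding eventually_sequentially .
  from choice[OF this] obtain n0 where n0: "\<And>K. \<forall>n\<ge>n0 K. \<forall>\<omega>\<in>A n.
        \<bar>U n \<omega>\<bar> \<le> ereal (K * r n) \<longrightarrow> \<bar>V n \<omega>\<bar> \<le> ereal (K' K * s n)"
    by blast
  \<comment> \<open>Restricting \<open>K\<close> to natural numbers leaves countably many pairs
    \<open>k\<close>, \<open>n\<close>, so that the exceptional null sets can be united.\<close>
  have "AE \<omega> in M. n0 (real k) \<le> n \<longrightarrow> \<omega> \<in> A n \<longrightarrow> U' n \<omega> \<le> ereal (real k * r n)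
      \<longrightarrow> V' n \<omega> \<le> ereal (K' (real k) * s n)" for k n
  proof (cases "n0 (real k) \<le> n")
    case True
    \<comment> \<open>Using the majorant \<open>U' n\<close> in place of
      \<open>\<bar>U n\<bar>\<close> makes \<open>?G\<close> measurable; off \<open>?G\<close> the
      value \<open>\<infinity>\<close> dominates trivially.\<close>
    let ?G = "{\<omega>\<in>space M. \<omega> \<in> A n \<and> U' n \<omega> \<le> ereal (real k * r n)}"
    let ?W = "\<lambda>\<omega>. if \<omega> \<in> ?G then ereal (K' (real k) * s n) else \<infinity>"
    have "?W \<in> borel_measurable M"
      by measurable
    moreover have "AE \<omega> in M. \<bar>V n \<omega>\<bar> \<le> ?W \<omega>"
    proof (rule AE_I2)
      fix \<omega> assume "\<omega> \<in> space M"
      then show "\<bar>V n \<omega>\<bar> \<le> ?W \<omega>"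
        using n0 True order_trans[OF U'_ge] by auto
    qed
    ultimately have "AE \<omega> in M. V' n \<omega> \<le> ?W \<omega>"
      by (rule V'_min)
    then show ?thesis
      using AE_space by eventually_elim auto
  qed simp
  then have "AE \<omega> in M. \<forall>k n. n0 (real k) \<le> n \<longrightarrow> \<omega> \<in> A n \<longrightarrow> U' n \<omega> \<le> ereal (real k * r n)
      \<longrightarrow> V' n \<omega> \<le> ereal (K' (real k) * s n)"
    by (simp add: AE_all_countable)
  then have "AE \<omega> in M. limsup (\<lambda>n. V' n \<omega> / ereal (s n)) < \<infinity>"
    using ev U'_lim
  proof eventually_elim
    case (elim \<omega>)
    note V'_le = elim(1)
    obtain k :: nat where "limsup (\<lambda>n. U' n \<omega> / ereal (r n)) < ereal (real k)"
      using elim(3) less_PInf_Ex_of_nat by auto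
    then have "\<forall>\<^sub>F n in sequentially. U' n \<omega> / ereal (r n) < ereal (real k)"
      by (rule Limsup_lessD)
    then have "\<forall>\<^sub>F n in sequentially. V' n \<omega> / ereal (s n) \<le> ereal (K' (real k))"
      using elim(2) eventually_ge_at_top[of "n0 (real k)"]
    proof eventually_elim
      case (elim n)
      have "U' n \<omega> \<le> ereal (real k * r n)"
        using elim(1) pos(1)[of n]
        by (simp add: ereal_divide_less_iff mult.commute less_imp_le)
      then have "V' n \<omega> \<le> ereal (K' (real k) * s n)"
        using V'_le elim by blast
      then show ?case
        using pos(2)[of n] by (simp add: ereal_divide_le_pos mult.commute)
    qed
    then have "limsup (\<lambda>n. V' n \<omega> / ereal (s n)) \<le> ereal (K' (real k))"
      by (rule Limsup_bounded)
    then show ?case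
      using le_less_trans by fastforce
  qed
  then show ?thesis
    using V' unfolding bigo_outer_as_def by blast
qed

end

section \<open>Deterministic stability of minimization\<close>

text \<open>Taking infima is 1-Lipschitz for the uniform distance. An infinite supremum makes the
  bound trivial, and a finite one forces the infimum of \<open>g\<close> to be finite as
  well.\<close>

lemma abs_INF_diff_le_SUP:
  fixes f g :: "'x \<Rightarrow> real"
  assumes "X \<noteq> {}" and \<psi>: "(INF x\<in>X. ereal (f x)) = ereal \<psi>"
  shows "\<bar>(INF x\<in>X. ereal (g x)) - ereal \<psi>\<bar> \<le> (SUP x\<in>X. ereal \<bar>g x - f x\<bar>)"
proof (cases "SUP x\<in>X. ereal \<bar>g x - f x\<bar>")
  case (real d)
  have d: "\<bar>g x - f x\<bar> \<le> d" if "x \<in> X" for x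
    using SUP_upper[OF that, of "\<lambda>x. ereal \<bar>g x - f x\<bar>"] real by simp
  have \<psi>_le: "\<psi> \<le> f x" if "x \<in> X" for x
    using INF_lower[OF that, of "\<lambda>x. ereal (f x)"] \<psi> by simp
  have lower: "ereal (\<psi> - d) \<le> (INF x\<in>X. ereal (g x))"
    using d \<psi>_le by (intro INF_greatest) (force simp: abs_le_iff)
  have "(INF x\<in>X. ereal (g x)) - ereal d \<le> (INF x\<in>X. ereal (f x))"
  proof (rule INF_greatest)
    fix x assume "x \<in> X"
    then have "(INF x\<in>X. ereal (g x)) \<le> ereal (g x)" by (rule INF_lower)
    also have "\<dots> \<le> ereal (f x + d)" using d[OF \<open>x \<in> X\<close>] by simp
    finally show "(INF x\<in>X. ereal (g x)) - ereal d \<le> ereal (f x)"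
      by (simp add: ereal_minus_le)
  qed
  then have "(INF x\<in>X. ereal (g x)) \<le> ereal (\<psi> + d)"
    by (simp add: \<psi> ereal_minus_le)
  then show ?thesis
    using lower real by (cases "INF x\<in>X. ereal (g x)") auto
next
  case MInf
  obtain x where "x \<in> X" using assms(1) by blast
  then have "ereal \<bar>g x - f x\<bar> \<le> (SUP x\<in>X. ereal \<bar>g x - f x\<bar>)" by (rule SUP_upper)
  then show ?thesis using MInf by simp
qed simp

text \<open>The excess splits into \<open>f x - g x\<close>, the gap of \<open>g x\<close> above its
  infimum, and the difference of the two infima. The first and the last are each at most the uniform
  deviation, the middle one is at most \<delta>.\<close>

lemma near_minimizer_excess_le:
  fixes f g :: "'x \<Rightarrow> real"
  assumes \<psi>: "(INF x\<in>X. ereal (f x)) = ereal \<psi>"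
    and "x \<in> X" "ereal (g x) \<le> (INF x\<in>X. ereal (g x)) + ereal \<delta>"
  shows "ereal (f x - \<psi>) \<le> 2 * (SUP x\<in>X. ereal \<bar>g x - f x\<bar>) + ereal \<delta>"
proof (cases "SUP x\<in>X. ereal \<bar>g x - f x\<bar>")
  case (real d)
  have "X \<noteq> {}" using assms(2) by blast
  have "\<bar>g x - f x\<bar> \<le> d"
    using SUP_upper[OF assms(2), of "\<lambda>x. ereal \<bar>g x - f x\<bar>"] real by simp
  moreover have "g x - \<psi> \<le> d + \<delta>"
    using abs_INF_diff_le_SUP[OF \<open>X \<noteq> {}\<close> \<psi>, of g] assms(3) real
    by (cases "INF x\<in>X. ereal (g x)") (auto simp: abs_le_iff)
  ultimately show ?thesis
    by (simp add: real numeral_eq_ereal)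
next
  case MInf
  have "ereal \<bar>g x - f x\<bar> \<le> (SUP x\<in>X. ereal \<bar>g x - f x\<bar>)"
    using assms(2) by (rule SUP_upper)
  then show ?thesis using MInf by simp
qed simp

text \<open>The real number \<psi> turns later computations in \<open>ereal\<close> into real ones;
  \<open>B\<close> bounds the excess where nothing is known about the minimizers.\<close>

lemma bounded_INF_real:
  fixes f :: "'x \<Rightarrow> real"
  assumes "X \<noteq> {}" "bounded (f ` X)"
  obtains \<psi> B where "(INF x\<in>X. ereal (f x)) = ereal \<psi>"
    "\<And>x. x \<in> X \<Longrightarrow> \<psi> \<le> f x" "\<And>x. x \<in> X \<Longrightarrow> f x - \<psi> \<le> B"
proof -
  obtain b where b: "\<And>x. x \<in> X \<Longrightarrow> \<bar>f x\<bar> \<le> b"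
    using assms(2) by (auto simp: bounded_iff)
  obtain x0 where "x0 \<in> X" using assms(1) by blast
  have "ereal (- b) \<le> (INF x\<in>X. ereal (f x))"
    using b by (intro INF_greatest) (force simp: abs_le_iff)
  moreover have "(INF x\<in>X. ereal (f x)) \<le> ereal (f x0)"
    using \<open>x0 \<in> X\<close> by (rule INF_lower)
  ultimately obtain \<psi> where \<psi>: "(INF x\<in>X. ereal (f x)) = ereal \<psi>"
    by (cases "INF x\<in>X. ereal (f x)") auto
  have "\<psi> \<le> f x" if "x \<in> X" for x
    using INF_lower[OF that, of "\<lambda>x. ereal (f x)"] \<psi> by simp
  moreover have "f x - \<psi> \<le> b - \<psi>" if "x \<in> X" for x
    using b[OF that] by simp
  ultimately show thesis
    using that \<psi> by blast
qed

section \<open>The membership events exhaust the probability space\<close>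

context prob_space
begin

text \<open>Continuity from below supplies the vanishing exceptional probability for
  \<open>bigo_outer_prob_transfer\<close>.\<close>

lemma min_membership_events_tendsto:
  assumes "min_membership_events M X h \<xi> \<delta> xh A"
  shows "(\<lambda>n. prob (space M - A n)) \<longlonglongrightarrow> 0"
proof -
  have A: "range A \<subseteq> events" "incseq A" "prob (\<Union>n. A n) = 1"
    using assms by (auto simp: min_membership_events_def incseq_Suc_iff)
  have "(\<lambda>n. 1 - prob (A n)) \<longlonglongrightarrow> 1 - 1"
    using finite_Lim_measure_incseq[OF A(1,2)] A(3) by (intro tendsto_diff tendsto_const) simp
  moreover have "prob (space M - A n) = 1 - prob (A n)" for n
    using A(1) by (intro prob_compl) auto
  ultimately show ?thesis by simp
qed

text \<open>As the events increase, an outcome in their union lies in all late ones, which is what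
  \<open>bigo_outer_as_transfer\<close> asks for.\<close>

lemma min_membership_events_AE:
  assumes "min_membership_events M X h \<xi> \<delta> xh A"
  shows "AE \<omega> in M. \<forall>\<^sub>F n in sequentially. \<omega> \<in> A n"
proof -
  have A: "range A \<subseteq> events" "incseq A" "prob (\<Union>n. A n) = 1"
    using assms by (auto simp: min_membership_events_def incseq_Suc_iff)
  have "AE \<omega> in M. \<omega> \<in> (\<Union>n. A n)"
    using A by (intro AE_prob_1) auto
  then show ?thesis
  proof eventually_elim
    case (elim \<omega>)
    then obtain N where "\<omega> \<in> A N" by blast
    then show ?case
      using incseqD[OF A(2)] unfolding eventually_sequentially by blast
  qed
qed

end

text \<open>The bound arises by taking \<kappa>-th roots. Since \<open>K\<close> is arbitrary,
  \<open>max K 0\<close> keeps the base of the power nonnegative.\<close>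

lemma powr_rate_transfer:
  fixes D \<alpha> \<kappa> :: real
  assumes "0 < \<alpha>" "1 \<le> \<kappa>" "0 \<le> D" "0 < r" "\<alpha> * D powr \<kappa> \<le> K * r"
  shows "D \<le> (max K 0 / \<alpha>) powr (1 / \<kappa>) * r powr (1 / \<kappa>)"
proof -
  have "K * r \<le> max K 0 * r"
    using \<open>0 < r\<close> by (intro mult_right_mono) auto
  then have "D powr \<kappa> \<le> max K 0 / \<alpha> * r"
    using assms by (simp add: field_simps order_trans[OF assms(5)])
  then have "(D powr \<kappa>) powr (1 / \<kappa>) \<le> (max K 0 / \<alpha> * r) powr (1 / \<kappa>)"
    using \<open>1 \<le> \<kappa>\<close> by (intro powr_mono2) auto
  moreover have "(D powr \<kappa>) powr (1 / \<kappa>) = D"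
    using assms by (simp add: powr_powr)
  moreover have "(max K 0 / \<alpha> * r) powr (1 / \<kappa>) = (max K 0 / \<alpha>) powr (1 / \<kappa>) * r powr (1 / \<kappa>)"
    by (rule powr_mult)
  ultimately show ?thesis
    by linarith
qed

theorem corollary4p3:
  fixes M :: "'a measure" and G :: "'b measure" and P :: "'b measure"
    and \<xi> :: "nat \<Rightarrow> 'a \<Rightarrow> 'b" and X :: "'x set" and h :: "'x \<Rightarrow> 'b \<Rightarrow> real"
    and \<iota> :: "'x \<Rightarrow> real ^ 'd" and r :: "nat \<Rightarrow> real"
  assumes "prob_space M"
    and "prob_space.indep_vars M (\<lambda>_. G) \<xi> UNIV"
    and "\<forall>i. distr M G (\<xi> i) = P"
    and "X \<noteq> {}"
    and "\<forall>x\<in>X. h x \<in> borel_measurable G \<and> integrable P (h x)"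
    and "bounded_regime M X h \<xi>"
    and "\<forall>n. 0 < r n" and "decseq r" and "r \<longlonglongrightarrow> 0"
  shows
    "(bigo_outer_prob M (sup_dev M X h \<xi>) r \<longrightarrow>
        bigo_outer_prob M (\<lambda>n \<omega>. emp_val X h \<xi> n \<omega> - true_val M X h \<xi>) r \<and>
        (\<forall>\<delta> xh. (\<forall>n. 0 \<le> \<delta> n) \<and> \<delta> \<in> O(r) \<and> (\<forall>n. xh n \<in> space M \<rightarrow> X) \<and>
                min_membership M X h \<xi> \<delta> xh \<longrightarrow>
           bigo_outer_prob M (\<lambda>n \<omega>. ereal (true_obj M h \<xi> (xh n \<omega>)) - true_val M X h \<xi>) r \<and>
           (\<forall>\<kappa>. sharp_growth M X h \<xi> \<iota> \<kappa> \<longrightarrow>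
              bigo_outer_prob M (\<lambda>n \<omega>. ereal (dist_sol M X h \<xi> \<iota> (xh n \<omega>))) (\<lambda>n. r n powr (1 / \<kappa>)))))
     \<and>
     (bigo_outer_as M (sup_dev M X h \<xi>) r \<longrightarrow>
        bigo_outer_as M (\<lambda>n \<omega>. \<bar>emp_val X h \<xi> n \<omega> - true_val M X h \<xi>\<bar>) r \<and>
        (\<forall>\<delta> xh. (\<forall>n. 0 \<le> \<delta> n) \<and> \<delta> \<in> O(r) \<and> (\<forall>n. xh n \<in> space M \<rightarrow> X) \<and>
                min_membership M X h \<xi> \<delta> xh \<longrightarrow>
           bigo_outer_as M (\<lambda>n \<omega>. ereal (true_obj M h \<xi> (xh n \<omega>)) - true_val M X h \<xi>) r \<and>
           (\<forall>\<kappa>. sharp_growth M X h \<xi> \<iota> \<kappa> \<longrightarrow>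
              bigo_outer_as M (\<lambda>n \<omega>. ereal (dist_sol M X h \<xi> \<iota> (xh n \<omega>))) (\<lambda>n. r n powr (1 / \<kappa>)))))
     \<and>
     (bigo_ereal (\<lambda>n. outer_expectation M (sup_dev M X h \<xi> n)) r \<longrightarrow>
        bigo_ereal (\<lambda>n. outer_expectation M (\<lambda>\<omega>. \<bar>emp_val X h \<xi> n \<omega> - true_val M X h \<xi>\<bar>)) r \<and>
        (\<forall>\<delta> xh. (\<forall>n. 0 \<le> \<delta> n) \<and> \<delta> \<in> O(r) \<and> (\<forall>n. xh n \<in> space M \<rightarrow> X) \<and>
                (\<exists>A. min_membership_events M X h \<xi> \<delta> xh A \<and>
                     (\<lambda>n. measure M (space M - A n)) \<in> O(r)) \<longrightarrow>
           bigo_ereal (\<lambda>n. outer_expectation M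
              (\<lambda>\<omega>. ereal (true_obj M h \<xi> (xh n \<omega>)) - true_val M X h \<xi>)) r \<and>
           (\<forall>\<kappa>. sharp_growth M X h \<xi> \<iota> \<kappa> \<longrightarrow>
              bigo_ereal (\<lambda>n. outer_expectation M
                (\<lambda>\<omega>. ereal (dist_sol M X h \<xi> \<iota> (xh n \<omega>) powr \<kappa>))) r)))"
proof -
  interpret prob_space M by fact
  let ?f = "true_obj M h \<xi>" and ?\<Delta> = "sup_dev M X h \<xi>" and ?d = "dist_sol M X h \<xi> \<iota>"
  have r_pos: "0 < r n" for n
    using assms(7) by blast
  obtain \<psi> B where INF_f: "(INF x\<in>X. ereal (?f x)) = ereal \<psi>"
    and \<psi>_le: "\<And>x. x \<in> X \<Longrightarrow> \<psi> \<le> ?f x" and le_B: "\<And>x. x \<in> X \<Longrightarrow> ?f x - \<psi> \<le> B"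
    using bounded_INF_real[of X ?f] assms(4,6) unfolding bounded_regime_def by blast
  have val: "true_val M X h \<xi> = ereal \<psi>"
    by (simp add: true_val_def INF_f)
  have "0 \<le> B"
    using \<psi>_le le_B assms(4) by fastforce

  \<comment> \<open>Pointwise inequalities as implications between rate bounds\<close>
  let ?V = "\<lambda>n \<omega>. \<bar>emp_val X h \<xi> n \<omega> - ereal \<psi>\<bar>"
  have V_le: "?V n \<omega> \<le> ?\<Delta> n \<omega>" for n \<omega>
    using abs_INF_diff_le_SUP[OF assms(4) INF_f] by (simp add: emp_val_def sup_dev_def)
  have \<Delta>_nonneg: "0 \<le> ?\<Delta> n \<omega>" for n \<omega>
    using abs_ereal_pos V_le by (rule order_trans)
  have V_imp: "\<exists>K'. \<forall>\<^sub>F n in sequentially. \<forall>\<omega>\<in>space M.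
      \<bar>?\<Delta> n \<omega>\<bar> \<le> ereal (K * r n) \<longrightarrow> ?V n \<omega> \<le> ereal (K' * r n)" for K
    using order_trans[OF V_le] \<Delta>_nonneg
    by (intro exI[of _ K] always_eventually) simp
  have exc_le: "ereal (?f (xh n \<omega>) - \<psi>) \<le> 2 * ?\<Delta> n \<omega> + ereal (\<delta> n)"
    if "min_membership_events M X h \<xi> \<delta> xh A" "\<omega> \<in> A n" for \<delta> xh A n \<omega>
  proof -
    \<comment> \<open>Membership is used on the diagonal \<open>N = n\<close>, which leaves a single
      event for each sample size.\<close>
    have "xh n \<omega> \<in> emp_sol X h \<xi> n (\<delta> n) \<omega>"
      using that unfolding min_membership_events_def by blast
    then show ?thesis
      unfolding sup_dev_def
      by (intro near_minimizer_excess_le[OF INF_f]) (auto simp: emp_sol_def emp_val_def)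
  qed
  have exc_imp: "\<exists>K'. \<forall>\<^sub>F n in sequentially. \<forall>\<omega>\<in>A n.
      \<bar>?\<Delta> n \<omega>\<bar> \<le> ereal (K * r n) \<longrightarrow> \<bar>ereal (?f (xh n \<omega>)) - ereal \<psi>\<bar> \<le> ereal (K' * r n)"
    if mem: "min_membership_events M X h \<xi> \<delta> xh A" and "\<delta> \<in> O(r)"
      and X: "\<forall>n. xh n \<in> space M \<rightarrow> X" for \<delta> xh A K
  proof -
    obtain C where "\<forall>\<^sub>F n in sequentially. norm (\<delta> n) \<le> C * norm (r n)"
      using landau_o.bigE[OF \<open>\<delta> \<in> O(r)\<close>] by blast
    \<comment> \<open>The constant is \<open>exc_le\<close> with \<open>K * r n\<close> inserted for
      the deviation and \<open>C * r n\<close> for \<open>\<delta> n\<close>.\<close>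
    then have "\<forall>\<^sub>F n in sequentially. \<forall>\<omega>\<in>A n. \<bar>?\<Delta> n \<omega>\<bar> \<le> ereal (K * r n) \<longrightarrow>
        \<bar>ereal (?f (xh n \<omega>)) - ereal \<psi>\<bar> \<le> ereal ((2 * K + C) * r n)"
    proof eventually_elim
      case (elim n)
      show ?case
      proof (intro ballI impI)
        fix \<omega> assume \<omega>: "\<omega> \<in> A n" and \<Delta>: "\<bar>?\<Delta> n \<omega>\<bar> \<le> ereal (K * r n)"
        have "xh n \<omega> \<in> X"
          using mem \<omega> unfolding min_membership_events_def emp_sol_def by blast
        moreover have "?f (xh n \<omega>) - \<psi> \<le> (2 * K + C) * r n"
          using exc_le[OF mem \<omega>] \<Delta> elim r_pos[of n] \<Delta>_nonneg[of n \<omega>]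
          by (cases "?\<Delta> n \<omega>") (auto simp: algebra_simps numeral_eq_ereal)
        ultimately show "\<bar>ereal (?f (xh n \<omega>)) - ereal \<psi>\<bar> \<le> ereal ((2 * K + C) * r n)"
          using \<psi>_le by simp
      qed
    qed
    then show ?thesis ..
  qed
  have growth: "\<exists>\<alpha>>0. \<forall>x\<in>X. \<alpha> * ?d x powr \<kappa> \<le> ?f x - \<psi>" if "sharp_growth M X h \<xi> \<iota> \<kappa>" for \<kappa>
    using that by (auto simp: sharp_growth_def val)
  have d_nonneg: "0 \<le> ?d x" for x
    by (simp add: dist_sol_def infdist_nonneg)
  \<comment> \<open>The distance is compared with the excess. Growth holds at every feasible point,
    so this implication is valid on all of \<open>space M\<close> and no event has to be
    removed.\<close>
  have dist_imp: "\<exists>K'. \<forall>\<^sub>F n in sequentially. \<forall>\<omega>\<in>space M.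
      \<bar>ereal (?f (xh n \<omega>)) - ereal \<psi>\<bar> \<le> ereal (K * r n) \<longrightarrow>
      \<bar>ereal (?d (xh n \<omega>))\<bar> \<le> ereal (K' * r n powr (1 / \<kappa>))"
    if growth_\<kappa>: "sharp_growth M X h \<xi> \<iota> \<kappa>" and X: "\<forall>n. xh n \<in> space M \<rightarrow> X" for xh K \<kappa>
  proof -
    have "1 \<le> \<kappa>" using growth_\<kappa> by (simp add: sharp_growth_def)
    obtain \<alpha> where \<alpha>: "0 < \<alpha>" "\<And>x. x \<in> X \<Longrightarrow> \<alpha> * ?d x powr \<kappa> \<le> ?f x - \<psi>"
      using growth[OF growth_\<kappa>] by blast
    have "\<bar>ereal (?d (xh n \<omega>))\<bar> \<le> ereal ((max K 0 / \<alpha>) powr (1 / \<kappa>) * r n powr (1 / \<kappa>))"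
      if "\<omega> \<in> space M" "\<bar>ereal (?f (xh n \<omega>)) - ereal \<psi>\<bar> \<le> ereal (K * r n)" for n \<omega>
    proof -
      have "\<alpha> * ?d (xh n \<omega>) powr \<kappa> \<le> K * r n"
        using \<alpha>(2)[of "xh n \<omega>"] X that by (fastforce simp: abs_le_iff)
      then show ?thesis
        using powr_rate_transfer[OF \<alpha>(1) \<open>1 \<le> \<kappa>\<close> d_nonneg r_pos] d_nonneg by simp
    qed
    then show ?thesis
      by (intro exI[of _ "(max K 0 / \<alpha>) powr (1 / \<kappa>)"] always_eventually) blast
  qed

  \<comment> \<open>Rates in outer probability\<close>
  have part1: "bigo_outer_prob M (\<lambda>n \<omega>. emp_val X h \<xi> n \<omega> - ereal \<psi>) r \<and>
      (\<forall>\<delta> xh. (\<forall>n. 0 \<le> \<delta> n) \<and> \<delta> \<in> O(r) \<and> (\<forall>n. xh n \<in> space M \<rightarrow> X) \<and>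
          min_membership M X h \<xi> \<delta> xh \<longrightarrow>
        bigo_outer_prob M (\<lambda>n \<omega>. ereal (?f (xh n \<omega>)) - ereal \<psi>) r \<and>
        (\<forall>\<kappa>. sharp_growth M X h \<xi> \<iota> \<kappa> \<longrightarrow>
          bigo_outer_prob M (\<lambda>n \<omega>. ereal (?d (xh n \<omega>))) (\<lambda>n. r n powr (1 / \<kappa>))))"
    if \<Delta>: "bigo_outer_prob M ?\<Delta> r"
  proof (intro conjI allI impI; (elim conjE)?)
    show "bigo_outer_prob M (\<lambda>n \<omega>. emp_val X h \<xi> n \<omega> - ereal \<psi>) r"
      by (rule bigo_outer_prob_transfer[OF \<Delta>, of "\<lambda>_. space M"]) (use V_imp in auto)
  next
    fix \<delta> xh
    assume \<delta>: "\<delta> \<in> O(r)" and X: "\<forall>n. xh n \<in> space M \<rightarrow> X"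
      and "min_membership M X h \<xi> \<delta> xh"
    then obtain A where A: "min_membership_events M X h \<xi> \<delta> xh A"
      unfolding min_membership_def by blast
    show exc: "bigo_outer_prob M (\<lambda>n \<omega>. ereal (?f (xh n \<omega>)) - ereal \<psi>) r"
      by (rule bigo_outer_prob_transfer[OF \<Delta> _ min_membership_events_tendsto[OF A] exc_imp[OF A \<delta> X]])
        (use A in \<open>auto simp: min_membership_events_def\<close>)
    show "bigo_outer_prob M (\<lambda>n \<omega>. ereal (?d (xh n \<omega>))) (\<lambda>n. r n powr (1 / \<kappa>))"
      if "sharp_growth M X h \<xi> \<iota> \<kappa>" for \<kappa>
      by (rule bigo_outer_prob_transfer[OF exc _ _ dist_imp[OF that X]]) auto
  qed

  \<comment> \<open>Rates almost surely, for minimal measurable majorants\<close>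
  have part2: "bigo_outer_as M ?V r \<and>
      (\<forall>\<delta> xh. (\<forall>n. 0 \<le> \<delta> n) \<and> \<delta> \<in> O(r) \<and> (\<forall>n. xh n \<in> space M \<rightarrow> X) \<and>
          min_membership M X h \<xi> \<delta> xh \<longrightarrow>
        bigo_outer_as M (\<lambda>n \<omega>. ereal (?f (xh n \<omega>)) - ereal \<psi>) r \<and>
        (\<forall>\<kappa>. sharp_growth M X h \<xi> \<iota> \<kappa> \<longrightarrow>
          bigo_outer_as M (\<lambda>n \<omega>. ereal (?d (xh n \<omega>))) (\<lambda>n. r n powr (1 / \<kappa>))))"
    if \<Delta>: "bigo_outer_as M ?\<Delta> r"
  proof (intro conjI allI impI; (elim conjE)?)
    show "bigo_outer_as M ?V r"
      by (rule bigo_outer_as_transfer[OF \<Delta> r_pos r_pos, of "\<lambda>_. space M"]) (use V_imp in auto)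
  next
    fix \<delta> xh
    assume \<delta>: "\<delta> \<in> O(r)" and X: "\<forall>n. xh n \<in> space M \<rightarrow> X"
      and "min_membership M X h \<xi> \<delta> xh"
    then obtain A where A: "min_membership_events M X h \<xi> \<delta> xh A"
      unfolding min_membership_def by blast
    show exc: "bigo_outer_as M (\<lambda>n \<omega>. ereal (?f (xh n \<omega>)) - ereal \<psi>) r"
      by (rule bigo_outer_as_transfer[OF \<Delta> r_pos r_pos _ min_membership_events_AE[OF A]
            exc_imp[OF A \<delta> X]])
        (use A in \<open>auto simp: min_membership_events_def\<close>)
    \<comment> \<open>The transfer divides by the new rate, and
      \<open>r n powr (1 / \<kappa>)\<close> is positive because \<open>r n\<close> is
      nonzero.\<close>
    show "bigo_outer_as M (\<lambda>n \<omega>. ereal (?d (xh n \<omega>))) (\<lambda>n. r n powr (1 / \<kappa>))"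
      if "sharp_growth M X h \<xi> \<iota> \<kappa>" for \<kappa>
      by (rule bigo_outer_as_transfer[OF exc r_pos _ _ _ dist_imp[OF that X]])
        (use r_pos in \<open>auto simp: less_imp_neq[symmetric]\<close>)
  qed

  \<comment> \<open>Rates for outer means\<close>
  have part3: "bigo_ereal (\<lambda>n. outer_expectation M (?V n)) r \<and>
      (\<forall>\<delta> xh. (\<forall>n. 0 \<le> \<delta> n) \<and> \<delta> \<in> O(r) \<and> (\<forall>n. xh n \<in> space M \<rightarrow> X) \<and>
          (\<exists>A. min_membership_events M X h \<xi> \<delta> xh A \<and>
            (\<lambda>n. measure M (space M - A n)) \<in> O(r)) \<longrightarrow>
        bigo_ereal (\<lambda>n. outer_expectation M (\<lambda>\<omega>. ereal (?f (xh n \<omega>)) - ereal \<psi>)) r \<and>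
        (\<forall>\<kappa>. sharp_growth M X h \<xi> \<iota> \<kappa> \<longrightarrow>
          bigo_ereal (\<lambda>n. outer_expectation M (\<lambda>\<omega>. ereal (?d (xh n \<omega>) powr \<kappa>))) r))"
    if "bigo_ereal (\<lambda>n. outer_expectation M (?\<Delta> n)) r"
  proof (intro conjI allI impI; (elim conjE)?)
    obtain C where C: "\<forall>\<^sub>F n in sequentially. \<bar>outer_expectation M (?\<Delta> n)\<bar> \<le> ereal (C * r n)"
      using \<open>bigo_ereal (\<lambda>n. outer_expectation M (?\<Delta> n)) r\<close> unfolding bigo_ereal_def by blast
    \<comment> \<open>Raising the constant by 1 makes the bound strict, since \<open>r n\<close> is
      positive; the affine estimate needs this.\<close>
    have less: "u < ereal ((c + 1) * r n)" if "\<bar>u\<bar> \<le> ereal (c * r n)" for u c n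
      using that r_pos[of n] by (cases u) (auto simp: algebra_simps)
    show "bigo_ereal (\<lambda>n. outer_expectation M (?V n)) r"
      unfolding bigo_ereal_def
    proof (rule exI[of _ C], use C in eventually_elim)
      case (elim n)
      have "outer_expectation M (?V n) \<le> outer_expectation M (?\<Delta> n)"
        by (intro outer_expectation_mono V_le)
      moreover have "0 \<le> outer_expectation M (?V n)"
        by (intro outer_expectation_nonneg) simp
      ultimately show ?case
        using elim by simp
    qed
    fix \<delta> xh
    assume \<delta>_nonneg: "\<forall>n. 0 \<le> \<delta> n" and \<delta>: "\<delta> \<in> O(r)" and X: "\<forall>n. xh n \<in> space M \<rightarrow> X"
      and "\<exists>A. min_membership_events M X h \<xi> \<delta> xh A \<and> (\<lambda>n. measure M (space M - A n)) \<in> O(r)"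
    then obtain A where A: "min_membership_events M X h \<xi> \<delta> xh A"
      and PA: "(\<lambda>n. prob (space M - A n)) \<in> O(r)"
      by blast
    obtain C\<delta> where C\<delta>: "\<forall>\<^sub>F n in sequentially. norm (\<delta> n) \<le> C\<delta> * norm (r n)"
      using landau_o.bigE[OF \<delta>] by blast
    obtain CA where CA: "\<forall>\<^sub>F n in sequentially. norm (prob (space M - A n)) \<le> CA * norm (r n)"
      using landau_o.bigE[OF PA] by blast
    let ?E = "\<lambda>n \<omega>. ereal (?f (xh n \<omega>)) - ereal \<psi>"
    have E_nonneg: "0 \<le> ?E n \<omega>" if "\<omega> \<in> space M" for n \<omega>
      using \<psi>_le X that by fastforce
    \<comment> \<open>The three summands come from twice the deviation with its constant made
      strict, from \<open>\<delta> n\<close>, and from the excess bound \<open>B\<close> on the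
      complement of \<open>A n\<close>, whose probability is at most
      \<open>CA * r n\<close>.\<close>
    have "\<forall>\<^sub>F n in sequentially. \<bar>outer_expectation M (?E n)\<bar> \<le> ereal ((2 * (C + 1) + C\<delta> + B * CA) * r n)"
      using C C\<delta> CA
    proof eventually_elim
      case (elim n)
      have "outer_expectation M (?E n)
          \<le> ereal (2 * ((C + 1) * r n) + \<delta> n + B * prob (space M - A n))"
      proof (rule outer_expectation_affine_less[where U = "?\<Delta> n" and A = "A n"])
        show "?E n \<omega> \<le> ereal 2 * ?\<Delta> n \<omega> + ereal (\<delta> n)" if "\<omega> \<in> A n" for \<omega>
          using exc_le[OF A that] by simp
        show "?E n \<omega> \<le> ereal B" if "\<omega> \<in> space M - A n" for \<omega>
          using le_B X that by fastforce
      qed (use \<Delta>_nonneg less[OF elim(1)] \<delta>_nonneg \<open>0 \<le> B\<close> A in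
          \<open>auto simp: min_membership_events_def\<close>)
      also have "\<dots> \<le> ereal ((2 * (C + 1) + C\<delta> + B * CA) * r n)"
        using elim(2,3) r_pos[of n] mult_left_mono[of "prob (space M - A n)" "CA * r n" B] \<open>0 \<le> B\<close>
        by (auto simp: algebra_simps)
      finally show ?case
        using outer_expectation_nonneg[of M "?E n"] E_nonneg by simp
    qed
    then obtain C' where C': "\<forall>\<^sub>F n in sequentially. \<bar>outer_expectation M (?E n)\<bar> \<le> ereal (C' * r n)"
      by blast
    then show "bigo_ereal (\<lambda>n. outer_expectation M (?E n)) r"
      unfolding bigo_ereal_def by blast
    fix \<kappa> assume growth_\<kappa>: "sharp_growth M X h \<xi> \<iota> \<kappa>"
    obtain \<alpha> where \<alpha>: "0 < \<alpha>" "\<And>x. x \<in> X \<Longrightarrow> \<alpha> * ?d x powr \<kappa> \<le> ?f x - \<psi>"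
      using growth[OF growth_\<kappa>] by blast
    let ?D = "\<lambda>n \<omega>. ereal (?d (xh n \<omega>) powr \<kappa>)"
    \<comment> \<open>The \<kappa>-th power of the distance is linear in the excess, so dividing by
      \<alpha> suffices and no root of the rate appears. The affine estimate is applied with
      \<open>A = space M\<close>, where the exceptional term vanishes.\<close>
    show "bigo_ereal (\<lambda>n. outer_expectation M (?D n)) r"
      unfolding bigo_ereal_def
    proof (rule exI[of _ "(C' + 1) / \<alpha>"], use C' in eventually_elim)
      case (elim n)
      have "outer_expectation M (?D n)
          \<le> ereal (1 / \<alpha> * ((C' + 1) * r n) + 0 + 0 * prob (space M - space M))"
      proof (rule outer_expectation_affine_less[where U = "?E n" and A = "space M"])
        show "?D n \<omega> \<le> ereal (1 / \<alpha>) * ?E n \<omega> + ereal 0" if "\<omega> \<in> space M" for \<omega>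
        proof -
          have "xh n \<omega> \<in> X" using X that by blast
          from \<alpha>(2)[OF this] show ?thesis
            using \<alpha>(1) by (simp add: field_simps)
        qed
      qed (use E_nonneg less[OF elim] \<alpha>(1) in auto)
      then show ?case
        using outer_expectation_nonneg[of M "?D n"] by simp
    qed
  qed
  show ?thesis
    unfolding val using part1 part2 part3 by blast
qed

end
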